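(* Let $(G,\sigma)$ be a finite simple graph with a linear ordering of its vertices. Then $FF(G\Box G,\mathrm{lex})=2^{\lceil \log_2 FF(G,\sigma)\rceil}$, where $\mathrm{lex}$ is the lexicographic ordering of $V(G\Box G)$ induced by $\sigma$ on both factors.
   Context: $G\Box G$ is the Cartesian product: vertex set $V(G)\times V(G)$, with $(u,v)\sim(u',v')$ iff either $u=u'$ and $vv'\in E(G)$, or $uu'\in E(G)$ and $v=v'$. The First-Fit coloring with respect to a vertex ordering scans vertices in order and gives each the smallest positive integer not used on its previously colored neighbors; $FF$ denotes the number of colors used. Lexicographic ordering: $(u,v)$ precedes $(u',v')$ iff $\sigma(u)<\sigma(u')$, or $u=u'$ and $\sigma(v)<\sigma(v')$. *)

theory Defs
  imports Complex_Main "Graph_Theory.Pair_Digraph"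
begin

text \<open>
  Finite simple graphs are modelled by the locale \<open>pair_graph\<close>: an edge \<open>uv\<close> is the pair of
  arcs \<open>(u,v)\<close>, \<open>(v,u)\<close>.  A vertex ordering is a strict order relation: \<open>(u,v) \<in> r\<close> means that
  \<open>u\<close> precedes \<open>v\<close>.
\<close>

definition cart_prod ::
    "'a pair_pre_digraph \<Rightarrow> 'b pair_pre_digraph \<Rightarrow> ('a \<times> 'b) pair_pre_digraph"
    (infixr \<open>\<box>\<close> 80) where
  "G \<box> H = \<lparr> pverts = pverts G \<times> pverts H,
     parcs = {((u, v), (u', v')).
       u \<in> pverts G \<and> u = u' \<and> (v, v') \<in> parcs H \<or>
       (u, u') \<in> parcs G \<and> v \<in> pverts H \<and> v = v'} \<rparr>"

lemma pair_graph_cart_prod: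
  assumes "pair_graph G" and "pair_graph H"
  shows "pair_graph (G \<box> H)"
proof -
  interpret G: pair_graph G by fact
  interpret H: pair_graph H by fact
  have sub: "parcs (G \<box> H) \<subseteq> pverts (G \<box> H) \<times> pverts (G \<box> H)"
    by (auto simp: cart_prod_def dest: G.in_arcsD1 G.in_arcsD2 H.in_arcsD1 H.in_arcsD2)
  have fin: "finite (pverts (G \<box> H))"
    by (simp add: cart_prod_def G.pair_finite_verts H.pair_finite_verts)
  have sG: "(v, u) \<in> parcs G" if "(u, v) \<in> parcs G" for u v
    using G.pair_sym_arcs that by (auto simp: symmetric_def sym_def)
  have sH: "(v, u) \<in> parcs H" if "(u, v) \<in> parcs H" for u v
    using H.pair_sym_arcs that by (auto simp: symmetric_def sym_def)
  show ?thesis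
  proof
    show "finite (parcs (G \<box> H))"
      using finite_subset[OF sub] fin by simp
    show "symmetric (with_proj (G \<box> H))"
      by (auto simp: symmetric_def sym_def cart_prod_def intro: sG sH)
    show "fst e \<noteq> snd e" if "e \<in> parcs (G \<box> H)" for e
      using that by (auto simp: cart_prod_def dest: G.no_loops' H.no_loops')
  qed (use sub fin in auto)
qed

text \<open>
  The recursion runs along \<open>r\<close> restricted to the vertices, which is well-founded for a strict
  linear order on a finite vertex set; \<open>first_fit_eq\<close> is the resulting recursion equation.
\<close>

definition first_fit :: "'a pair_pre_digraph \<Rightarrow> 'a rel \<Rightarrow> 'a \<Rightarrow> nat" where
  "first_fit G r = wfrec (Restr r (pverts G))
     (\<lambda>c v. LEAST k. 0 < k \<and> k \<notin> c ` {u \<in> pverts G. (u, v) \<in> r \<and> (u, v) \<in> parcs G})"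

lemma first_fit_eq:
  assumes "pair_graph G" and "strict_linear_order_on (pverts G) r" and v: "v \<in> pverts G"
  shows "first_fit G r v =
    (LEAST k. 0 < k \<and> k \<notin> first_fit G r ` {u \<in> pverts G. (u, v) \<in> r \<and> (u, v) \<in> parcs G})"
proof -
  interpret pair_graph G by fact
  have "trans (Restr r (pverts G))" "irrefl (Restr r (pverts G))"
    using assms(2) by (auto simp: strict_linear_order_on_def irrefl_def intro: trans_Restr)
  then have "acyclic (Restr r (pverts G))"
    by (simp add: acyclic_irrefl)
  then have wf: "wf (Restr r (pverts G))"
    by (intro finite_acyclic_wf) (auto simp: pair_finite_verts)
  have "cut (first_fit G r) (Restr r (pverts G)) v ` {u \<in> pverts G. (u, v) \<in> r \<and> (u, v) \<in> parcs G}
      = first_fit G r ` {u \<in> pverts G. (u, v) \<in> r \<and> (u, v) \<in> parcs G}"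
    using v by (intro image_cong) (auto simp: cut_def)
  with def_wfrec[OF eq_reflection[OF first_fit_def] wf, of v] show ?thesis
    by simp
qed

definition FF :: "'a pair_pre_digraph \<Rightarrow> 'a rel \<Rightarrow> nat" where
  "FF G r = card (first_fit G r ` pverts G)"

end

theory Submission
  imports Defs
begin

text \<open>
  Shift all colours down by one, so that First-Fit assigns the minimal excludant of the colours of
  the earlier neighbours.  The minimal excludant of all \<open>a' XOR b\<close> with \<open>a' < a\<close> and all
  \<open>a XOR b'\<close> with \<open>b' < b\<close> is \<open>a XOR b\<close> (this is addition of nimbers), so the
  vertex \<open>(u, v)\<close> of \<open>G \<box> G\<close> receives the XOR of the colours of \<open>u\<close> and \<open>v\<close>.  The
  shifted colours of \<open>G\<close> are \<open>0, \<dots>, n - 1\<close>, and the values \<open>a XOR b\<close> with \<open>a, b < n\<close>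
  are exactly the numbers below the least power of two that is at least \<open>n\<close>.
\<close>

section \<open>Arithmetic of XOR on natural numbers\<close>

unbundle bit_operations_syntax

text \<open>At the highest bit where \<open>k\<close> and \<open>a XOR b\<close> differ, exactly one
  of \<open>a\<close> and \<open>b\<close> has a 1, and replacing that operand so that the XOR
  becomes \<open>k\<close> clears this bit and keeps all higher ones. The induction finds the bit by
  halving.\<close>

lemma xor_less_cases:
  fixes a b k :: nat
  assumes "k < a XOR b"
  shows "k XOR b < a \<or> k XOR a < b"
  using assms
proof (induction k arbitrary: a b rule: less_induct)
  case (less k)
  have less_iff: "x < y \<longleftrightarrow> x div 2 < y div 2 \<or> x div 2 = y div 2 \<and> even x \<and> odd y" for x y :: nat
    by presburger
  have div2: "(x XOR y) div 2 = x div 2 XOR y div 2" for x y :: nat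
    using drop_bit_xor[of 1 x y] by (simp add: drop_bit_eq_div)
  have parity: "even (x XOR y) \<longleftrightarrow> (even x \<longleftrightarrow> even y)" for x y :: nat
    by (simp add: even_xor_iff)
  consider "k div 2 < (a div 2) XOR (b div 2)"
    | "k div 2 = (a div 2) XOR (b div 2)" "even k" "odd (a XOR b)"
    using less.prems less_iff[of k "a XOR b"] unfolding div2 by blast
  then show ?case
  proof cases
    case 1
    have "k div 2 XOR b div 2 < a div 2 \<or> k div 2 XOR a div 2 < b div 2"
    \<comment> \<open>For \<open>k = 0\<close> halving does not decrease \<open>k\<close>; there it
      suffices that the halves of \<open>a\<close> and \<open>b\<close> differ.\<close>
    proof (cases "k = 0")
      case True
      have "a div 2 \<noteq> b div 2"
        using 1 by auto
      then show ?thesis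
        using True by auto
    next
      case False
      then show ?thesis
        using less.IH[of "k div 2"] 1 by simp
    qed
    then show ?thesis
      by (auto simp: less_iff[of "k XOR _"] div2)
  next
    case 2
    \<comment> \<open>Exactly one of \<open>a\<close> and \<open>b\<close> is odd. As
      \<open>k\<close> is even, the replacement for the odd one is even with the same half, hence
      one less.\<close>
    then have "k div 2 XOR b div 2 = a div 2" "k div 2 XOR a div 2 = b div 2"
      by (simp_all add: xor.assoc xor.commute[of _ "a div 2"] xor.assoc[symmetric, of "a div 2"])
    then show ?thesis
      using 2 by (auto simp: less_iff[of "k XOR _"] div2 parity)
  qed
qed

lemma xor_cancel:
  fixes a b c :: nat
  shows "a XOR c = b XOR c \<longleftrightarrow> a = b" and "c XOR a = c XOR b \<longleftrightarrow> a = b"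
  by (metis xor.assoc xor.commute xor.right_neutral xor_self_eq)+

text \<open>The hypotheses single out \<open>2 ^ m\<close> as the least power of two that is at
  least \<open>n\<close>, without logarithms. If \<open>k < n\<close>, use \<open>k XOR 0\<close>;
  otherwise the top bit of \<open>k\<close> is \<open>2 ^ j < n\<close>, which serves as one
  operand, and clearing it leaves the other.\<close>

lemma xor_image_below:
  fixes n m :: nat
  assumes "0 < n" "n \<le> 2 ^ m" "\<And>j. m = Suc j \<Longrightarrow> 2 ^ j < n"
  shows "(\<lambda>(a, b). a XOR b) ` ({..<n} \<times> {..<n}) = {..<2 ^ m}"
proof (intro equalityI subsetI)
  fix k assume "k \<in> (\<lambda>(a, b). a XOR b) ` ({..<n} \<times> {..<n})"
  then obtain a b where "k = a XOR b" "a < 2 ^ m" "b < 2 ^ m"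
    using assms(2) by auto
  \<comment> \<open>The numbers below \<open>2 ^ m\<close> are those fixed by
    \<open>take_bit m\<close>, which commutes with XOR.\<close>
  then show "k \<in> {..<2 ^ m}"
    by (metis lessThan_iff take_bit_nat_eq_self_iff take_bit_xor)
next
  fix k :: nat assume k: "k \<in> {..<2 ^ m}"
  have "\<exists>a<n. \<exists>b<n. k = a XOR b"
  proof (cases "k < n")
    case True
    then show ?thesis
      using assms(1) by (intro exI[of _ k] conjI exI[of _ 0]) auto
  next
    case False
    then obtain j where j: "m = Suc j"
      using k assms(1) by (cases m) auto
    then have nj: "2 ^ j < n" by (rule assms(3))
    have "k div 2 ^ j = 1"
      using nj False k j by (intro div_nat_eqI) auto
    then have "drop_bit j (k XOR 2 ^ j) = 0"
      by (simp add: drop_bit_xor) (simp add: drop_bit_eq_div)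
    then have "k XOR 2 ^ j < 2 ^ j"
      by (simp add: drop_bit_eq_div div_eq_0_iff)
    then show ?thesis
      using nj by (intro exI[of _ "k XOR 2 ^ j"] conjI exI[of _ "2 ^ j"]) (auto simp: xor.assoc)
  qed
  then show "k \<in> (\<lambda>(a, b). a XOR b) ` ({..<n} \<times> {..<n})"
    by force
qed

section \<open>First-Fit on a single ordered graph\<close>

context
  fixes G :: "'a pair_pre_digraph" and r :: "'a rel"
  assumes graph: "pair_graph G" and order: "strict_linear_order_on (pverts G) r"
begin

lemma first_fit_colour:
  assumes "v \<in> pverts G"
  shows "0 < first_fit G r v \<and>
    first_fit G r v \<notin> first_fit G r ` {u \<in> pverts G. (u, v) \<in> r \<and> (u, v) \<in> parcs G}"
proof -
  let ?N = "first_fit G r ` {u \<in> pverts G. (u, v) \<in> r \<and> (u, v) \<in> parcs G}"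
  interpret pair_graph G by (rule graph)
  \<comment> \<open>Inserting 0 forces the fresh colour to be positive.\<close>
  have "finite (insert 0 ?N)"
    by (simp add: pair_finite_verts)
  then obtain k where "k \<notin> insert 0 ?N"
    using ex_new_if_finite infinite_UNIV_nat by blast
  then have "0 < k \<and> k \<notin> ?N" by simp
  then show ?thesis
    unfolding first_fit_eq[OF graph order assms] by (rule LeastI)
qed

lemma first_fit_smaller_colour:
  assumes "v \<in> pverts G" "0 < k" "k < first_fit G r v"
  obtains u where "u \<in> pverts G" "(u, v) \<in> r" "(u, v) \<in> parcs G" "first_fit G r u = k"
  using assms(2) not_less_Least[OF assms(3)[unfolded first_fit_eq[OF graph order assms(1)]]]
  by (auto intro: that)

text \<open>By induction along the order, properness and attainment of all smaller colours determine
  each colour from the earlier ones. A guessed formula for First-Fit thus needs only these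
  checks.\<close>

lemma first_fit_unique:
  assumes pos: "\<And>v. v \<in> pverts G \<Longrightarrow> 0 < c v"
    and proper: "\<And>u v. \<lbrakk>v \<in> pverts G; u \<in> pverts G; (u, v) \<in> r; (u, v) \<in> parcs G\<rbrakk> \<Longrightarrow> c u \<noteq> c v"
    and smaller: "\<And>v k. \<lbrakk>v \<in> pverts G; 0 < k; k < c v\<rbrakk> \<Longrightarrow>
      \<exists>u\<in>pverts G. (u, v) \<in> r \<and> (u, v) \<in> parcs G \<and> c u = k"
    and "v \<in> pverts G"
  shows "first_fit G r v = c v"
proof -
  interpret pair_graph G by (rule graph)
  have "trans (Restr r (pverts G))" "irrefl (Restr r (pverts G))"
    using order by (auto simp: strict_linear_order_on_def irrefl_def intro: trans_Restr)
  then have "wf (Restr r (pverts G))"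
    by (intro finite_acyclic_wf) (auto simp: pair_finite_verts acyclic_irrefl)
  then show ?thesis
    using assms(4)
  proof (induction v rule: wf_induct_rule)
    case (less v)
    let ?N = "{u \<in> pverts G. (u, v) \<in> r \<and> (u, v) \<in> parcs G}"
    have "first_fit G r ` ?N = c ` ?N"
      using less by (intro image_cong) auto
    then have "first_fit G r v = (LEAST k. 0 < k \<and> k \<notin> c ` ?N)"
      by (simp add: first_fit_eq[OF graph order less.prems])
    also have "\<dots> = c v"
    proof (rule Least_equality)
      show "0 < c v \<and> c v \<notin> c ` ?N"
        using pos proper less.prems by fastforce
      show "c v \<le> k" if "0 < k \<and> k \<notin> c ` ?N" for k
        using smaller[OF less.prems, of k] that by (force simp: not_less[symmetric])
    qed
    finally show ?case .
  qed
qed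

text \<open>No colour is skipped, because a vertex of maximal colour has neighbours of every smaller
  positive colour. So the number of colours is also the largest one.\<close>

lemma first_fit_image: "first_fit G r ` pverts G = {1..FF G r}"
proof -
  let ?C = "first_fit G r ` pverts G"
  interpret pair_graph G by (rule graph)
  have fin: "finite ?C"
    by (simp add: pair_finite_verts)
  \<comment> \<open>The extra 0 gives a maximum, and an empty interval, when there are no
    vertices.\<close>
  have "?C = {1..Max (insert 0 ?C)}"
  proof (intro equalityI subsetI)
    fix k assume "k \<in> ?C"
    then show "k \<in> {1..Max (insert 0 ?C)}"
      using fin first_fit_colour by (auto simp: Suc_le_eq)
  next
    fix k assume k: "k \<in> {1..Max (insert 0 ?C)}"
    have "Max (insert 0 ?C) \<in> insert 0 ?C"
      using fin by (intro Max_in) auto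
    then obtain v where v: "v \<in> pverts G" "k \<le> first_fit G r v"
      using k by auto
    show "k \<in> ?C"
    proof (cases "k = first_fit G r v")
      case False
      then show ?thesis
        using v k first_fit_smaller_colour[of v k] by (auto simp: Suc_le_eq)
    qed (use v in auto)
  qed
  then show ?thesis
    unfolding FF_def by (metis card_atLeastAtMost diff_Suc_1)
qed

end

section \<open>First-Fit on the Cartesian product\<close>

lemma strict_linear_order_on_lex_prod:
  assumes "strict_linear_order_on A r" "strict_linear_order_on B s"
  shows "strict_linear_order_on (A \<times> B) (r <*lex*> s)"
  using assms
  by (auto simp: strict_linear_order_on_def irrefl_def total_on_def intro: trans_lex_prod)

text \<open>An edge changes one coordinate only, so the lexicographic comparison of its ends is that
  of one factor. Properness then follows by cancelling the common XOR operand, and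
  \<open>xor_less_cases\<close> supplies the smaller colours.\<close>

lemma first_fit_cart_prod:
  assumes G: "pair_graph G" "strict_linear_order_on (pverts G) r"
    and H: "pair_graph H" "strict_linear_order_on (pverts H) s"
    and uv: "u \<in> pverts G" "v \<in> pverts H"
  shows "first_fit (G \<box> H) (r <*lex*> s) (u, v) =
    Suc ((first_fit G r u - 1) XOR (first_fit H s v - 1))"
proof -
  define f where "f u = first_fit G r u - 1" for u
  define g where "g v = first_fit H s v - 1" for v
  have f: "first_fit G r u = Suc (f u)" if "u \<in> pverts G" for u
    using first_fit_colour[OF G that] by (simp add: f_def)
  have g: "first_fit H s v = Suc (g v)" if "v \<in> pverts H" for v
    using first_fit_colour[OF H that] by (simp add: g_def)
  have f_proper: "f u \<noteq> f u'"
    if "u \<in> pverts G" "u' \<in> pverts G" "(u, u') \<in> r" "(u, u') \<in> parcs G" for u u'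
    using first_fit_colour[OF G that(2)] that f[of u] f[of u']
    by (metis (mono_tags, lifting) image_eqI mem_Collect_eq)
  have g_proper: "g v \<noteq> g v'"
    if "v \<in> pverts H" "v' \<in> pverts H" "(v, v') \<in> s" "(v, v') \<in> parcs H" for v v'
    using first_fit_colour[OF H that(2)] that g[of v] g[of v']
    by (metis (mono_tags, lifting) image_eqI mem_Collect_eq)
  have f_smaller: "\<exists>u'\<in>pverts G. (u', u) \<in> r \<and> (u', u) \<in> parcs G \<and> f u' = k"
    if "u \<in> pverts G" "k < f u" for u k
    using first_fit_smaller_colour[OF G that(1), of "Suc k"] that f by auto
  have g_smaller: "\<exists>v'\<in>pverts H. (v', v) \<in> s \<and> (v', v) \<in> parcs H \<and> g v' = k"
    if "v \<in> pverts H" "k < g v" for v k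
    using first_fit_smaller_colour[OF H that(1), of "Suc k"] that g by auto
  \<comment> \<open>Irreflexivity excludes a strict comparison in the coordinate that an edge leaves
    fixed.\<close>
  have irrefl: "(x, x) \<notin> r" "(y, y) \<notin> s" for x y
    using G(2) H(2) by (auto simp: strict_linear_order_on_def irrefl_def)
  have "first_fit (G \<box> H) (r <*lex*> s) (u, v) = (\<lambda>(u, v). Suc (f u XOR g v)) (u, v)"
  proof (rule first_fit_unique[OF pair_graph_cart_prod[OF G(1) H(1)]])
    show "strict_linear_order_on (pverts (G \<box> H)) (r <*lex*> s)"
      using strict_linear_order_on_lex_prod[OF G(2) H(2)] by (simp add: cart_prod_def)
    show "(u, v) \<in> pverts (G \<box> H)"
      using uv by (simp add: cart_prod_def)
    show "0 < (\<lambda>(u, v). Suc (f u XOR g v)) p" for p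
      by (simp split: prod.split)
  next
    fix p q
    assume "q \<in> pverts (G \<box> H)" "p \<in> pverts (G \<box> H)"
      "(p, q) \<in> r <*lex*> s" "(p, q) \<in> parcs (G \<box> H)"
    then show "(\<lambda>(u, v). Suc (f u XOR g v)) p \<noteq> (\<lambda>(u, v). Suc (f u XOR g v)) q"
      using irrefl f_proper g_proper
      by (auto simp: cart_prod_def xor_cancel)
  next
    fix p and k :: nat
    assume p: "p \<in> pverts (G \<box> H)" and k: "0 < k" "k < (\<lambda>(u, v). Suc (f u XOR g v)) p"
    obtain u v where uv: "p = (u, v)" "u \<in> pverts G" "v \<in> pverts H"
      using p by (auto simp: cart_prod_def)
    obtain l where l: "k = Suc l" "l < f u XOR g v"
      using k uv by (cases k) auto
    from xor_less_cases[OF l(2)]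
    have "\<exists>u' v'. (u', v') \<in> pverts (G \<box> H) \<and> ((u', v'), p) \<in> r <*lex*> s \<and>
      ((u', v'), p) \<in> parcs (G \<box> H) \<and> Suc (f u' XOR g v') = k"
    proof
      assume "l XOR g v < f u"
      from f_smaller[OF uv(2) this] obtain u' where
        "u' \<in> pverts G" "(u', u) \<in> r" "(u', u) \<in> parcs G" "f u' = l XOR g v" by blast
      then show ?thesis
        using uv l by (intro exI[of _ u'] exI[of _ v]) (auto simp: cart_prod_def xor.assoc)
    next
      assume "l XOR f u < g v"
      from g_smaller[OF uv(3) this] obtain v' where
        "v' \<in> pverts H" "(v', v) \<in> s" "(v', v) \<in> parcs H" "g v' = l XOR f u" by blast
      then show ?thesis
        using uv l by (intro exI[of _ u] exI[of _ v'])
          (auto simp: cart_prod_def xor.left_commute[of "f u"])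
    qed
    then show "\<exists>q\<in>pverts (G \<box> H). (q, p) \<in> r <*lex*> s \<and> (q, p) \<in> parcs (G \<box> H) \<and>
        (\<lambda>(u, v). Suc (f u XOR g v)) q = k"
      by fastforce
  qed
  then show ?thesis
    by (simp add: f_def g_def)
qed

theorem theorem5:
  fixes G :: "'a pair_pre_digraph" and \<sigma> :: "'a rel"
  assumes "pair_graph G" and "pverts G \<noteq> {}"
    and "strict_linear_order_on (pverts G) \<sigma>"
  shows "FF (G \<box> G) (\<sigma> <*lex*> \<sigma>) = 2 ^ nat \<lceil>log 2 (real (FF G \<sigma>))\<rceil>"
proof -
  let ?n = "FF G \<sigma>" and ?V = "pverts G"
  define m where "m = nat \<lceil>log 2 (real ?n)\<rceil>"
  define f where "f u = first_fit G \<sigma> u - 1" for u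
  have image: "first_fit G \<sigma> ` ?V = {1..?n}"
    by (rule first_fit_image[OF assms(1,3)])
  \<comment> \<open>Without vertices the product would have 0 colours, which is no power of
    two.\<close>
  then have n: "0 < ?n"
    using assms(2) by (cases ?n) auto
  have "f ` ?V = (\<lambda>k. k - 1) ` {1..?n}"
    unfolding image[symmetric] image_image f_def ..
  also have "\<dots> = {..<?n}"
    using image_Suc_lessThan[of ?n] by (metis (no_types) diff_Suc_1 image_cong image_ident image_image)
  finally have f: "f ` ?V = {..<?n}" .
  have upper: "?n \<le> 2 ^ m"
  proof -
    have "log 2 ?n \<le> real m"
      unfolding m_def by linarith
    then have "real ?n \<le> 2 powr real m"
      using n by (simp add: log_le_iff)
    then have "real ?n \<le> real (2 ^ m)"
      by (simp add: powr_realpow)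
    then show ?thesis
      by (simp only: of_nat_le_iff)
  qed
  \<comment> \<open>A successor value of \<open>m\<close> means that \<open>nat\<close> truncated
    nothing, so the ceiling is \<open>j + 1\<close> and the logarithm exceeds
    \<open>j\<close>.\<close>
  have lower: "2 ^ j < ?n" if "m = Suc j" for j
  proof -
    have "real j < log 2 ?n"
      using that unfolding m_def by linarith
    then have "2 powr real j < real ?n"
      using n by (simp add: less_log_iff)
    then have "real (2 ^ j) < real ?n"
      by (simp add: powr_realpow)
    then show ?thesis
      by (simp only: of_nat_less_iff)
  qed
  have "first_fit (G \<box> G) (\<sigma> <*lex*> \<sigma>) ` pverts (G \<box> G) =
      (\<lambda>(u, v). Suc (f u XOR f v)) ` (?V \<times> ?V)"
    using first_fit_cart_prod[OF assms(1,3) assms(1,3)]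
    by (intro image_cong) (auto simp: cart_prod_def f_def)
  \<comment> \<open>The two coordinates range independently, so all pairs of shifted colours
    occur.\<close>
  also have "\<dots> = Suc ` (\<lambda>(a, b). a XOR b) ` (f ` ?V \<times> f ` ?V)"
    by force
  also have "\<dots> = Suc ` {..<2 ^ m}"
    unfolding f using xor_image_below[OF n upper lower] by simp
  finally show ?thesis
    unfolding FF_def m_def[unfolded FF_def, symmetric] by (simp add: card_image)
qed

end
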